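(* Consider a deterministic finite state machine $M$ with state transition equation $$q(t+1)=f(q(t),u(t),w(t)),$$ where the finite set $\mathcal Q$ is the state set and the finite sets $\mathcal U$ and $\mathcal W$ are the input sets. Let $\sigma:\mathcal Q\times\mathcal U\times\mathcal W\to\mathbb R$ be a given function. The following three statements are equivalent: (a) There exists a $\varphi:\mathcal Q\to\mathcal U$ such that the closed loop system $(M,\varphi)$ satisfies $$\inf_{T\ge0}\sum_{t=0}^{T}\sigma(q(t),\varphi(q(t)),w(t))>-\infty$$ (for every $\mathbf w\in\mathcal W^{\mathbb Z_+}$ and every $q(0)\in\mathcal Q$). (b) There exists a function $J:\mathcal Q\to\mathbb R_+$ such that $J(q)\ge\mathbb T(J)(q)$ for every $q\in\mathcal Q$, where $\mathbb T:\mathbb R^{\mathcal Q}\to\mathbb R^{\mathcal Q}$ is defined by $$\mathbb T(J)(q)=\min_{u\in\mathcal U}\max_{w\in\mathcal W}\{-\sigma(q,u,w)+J(f(q,u,w))\}.$$ (c) The sequence of functions $J_k:\mathcal Q\to\mathbb R$, $k\in\mathbb Z_+$, defined recursively by $$J_0=0,\qquad J_{k+1}=\max\{0,\mathbb T(J_k)\}$$ converges.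
   Context: $\mathbb Z_+$ and $\mathbb R_+$ denote the non-negative integers and non-negative reals. A deterministic finite state machine has finite (nonempty) state set and finite (nonempty) input sets, with transition function $f:\mathcal Q\times\mathcal U\times\mathcal W\to\mathcal Q$. The closed loop system $(M,\varphi)$ is the machine with input $w$ obtained by setting $u(t)=\varphi(q(t))$, i.e. $q(t+1)=f(q(t),\varphi(q(t)),w(t))$. The maximum of functions is taken pointwise, and convergence of $J_k$ means pointwise convergence on $\mathcal Q$ to a real-valued function. *)

theory Defs
  imports Complex_Main "HOL-Library.Extended_Real"
begin

text \<open>
  A deterministic finite state machine is given by its transition function
  \<open>f :: 'q \<Rightarrow> 'u \<Rightarrow> 'w \<Rightarrow> 'q\<close>, where the state set and the two input sets are the universes of types
  of class \<open>finite\<close>; such types are also nonempty.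
\<close>

definition closed_loop :: "('q \<Rightarrow> 'u \<Rightarrow> 'w \<Rightarrow> 'q) \<Rightarrow> ('q \<Rightarrow> 'u) \<Rightarrow> 'q \<Rightarrow> 'w \<Rightarrow> 'q" where
  "closed_loop f \<phi> = (\<lambda>q w. f q (\<phi> q) w)"

text \<open>\<open>traj g q0 w t\<close> is the state at time \<open>t\<close> of \<open>q(t+1) = g(q(t), w(t))\<close> with \<open>q(0) = q0\<close>.\<close>

primrec traj :: "('q \<Rightarrow> 'w \<Rightarrow> 'q) \<Rightarrow> 'q \<Rightarrow> (nat \<Rightarrow> 'w) \<Rightarrow> nat \<Rightarrow> 'q" where
  "traj g q0 w 0 = q0"
| "traj g q0 w (Suc t) = g (traj g q0 w t) (w t)"

definition bellman ::
  "('q \<Rightarrow> 'u::finite \<Rightarrow> 'w::finite \<Rightarrow> 'q) \<Rightarrow> ('q \<Rightarrow> 'u \<Rightarrow> 'w \<Rightarrow> real) \<Rightarrow> ('q \<Rightarrow> real) \<Rightarrow> 'q \<Rightarrow> real" where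
  "bellman f \<sigma> J q = (MIN u\<in>UNIV. MAX w\<in>UNIV. - \<sigma> q u w + J (f q u w))"

primrec value_iter ::
  "('q \<Rightarrow> 'u::finite \<Rightarrow> 'w::finite \<Rightarrow> 'q) \<Rightarrow> ('q \<Rightarrow> 'u \<Rightarrow> 'w \<Rightarrow> real) \<Rightarrow> nat \<Rightarrow> 'q \<Rightarrow> real" where
  "value_iter f \<sigma> 0 = (\<lambda>q. 0)"
| "value_iter f \<sigma> (Suc k) = (\<lambda>q. max 0 (bellman f \<sigma> (value_iter f \<sigma> k) q))"

end

theory Submission
  imports Defs
begin

text \<open>
  All three statements say that the cost \<open>- \<sigma>\<close>, accumulated against an adversarial input \<open>w\<close>,
  can be kept bounded by a memoryless choice of \<open>u\<close>. The Bellman inequality is used through one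
  reformulation (\<open>bellman_le_iff\<close>): \<open>bellman f \<sigma> J q \<le> c\<close> holds iff a single input \<open>u\<close> keeps every
  one-step cost plus \<open>J\<close> at the successor below \<open>c\<close>.

  From (b) to (a): an input attaining the minimum at each state defines \<open>\<phi>\<close>, and \<open>J\<close> acts as a
  storage function. Along closed loop trajectories the cost accumulated up to time \<open>T\<close> plus
  \<open>J (q(T))\<close> never exceeds \<open>J (q(0))\<close>, so the sums of \<open>\<sigma>\<close> are at least \<open>- J (q(0))\<close>.

  From (b) to (c) and back: the Bellman operator is monotone, so the iterates increase, and every
  solution of (b) bounds them from above. Conversely, the convergence of the iterates is uniform
  because there are finitely many states, so the limit is again a solution of (b).

  From (a) to (b): the natural candidate for \<open>J q\<close> is the supremum of the accumulated cost over all
  finite input words read from \<open>q\<close> in the closed loop. It dominates the empty word, hence is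
  nonnegative, and it satisfies the Bellman inequality by prefixing one letter. The difficulty is
  finiteness: (a) bounds the cost along each infinite input separately, whereas the supremum
  needs one bound for all of them. Call a state unbounded if its supremum is infinite. What
  a word costs after its first entry into a bounded state is bounded by the supremum there, and
  there are finitely many states, so a word loses at most a fixed amount of its cost when it is cut
  off just before that entry. Hence from an
  unbounded state some word costs at least 1 and ends in an unbounded state
  (\<open>unbounded_gain\<close>). Concatenating such words yields one infinite input of unbounded cost,
  which (a) excludes (\<open>bounded_word_cost\<close>).
\<close>

section \<open>The Bellman operator and value iteration\<close>

lemma bellman_le_iff:
  fixes f :: "'q \<Rightarrow> 'u::finite \<Rightarrow> 'w::finite \<Rightarrow> 'q"
  shows "bellman f \<sigma> J q \<le> c \<longleftrightarrow> (\<exists>u. \<forall>w. - \<sigma> q u w + J (f q u w) \<le> c)"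
  unfolding bellman_def by (subst Min_le_iff) auto

text \<open>The shift \<open>e\<close> combines monotonicity with nonexpansiveness in the sup norm: \<open>e = 0\<close> makes value
  iteration increase, \<open>e > 0\<close> lets the Bellman inequality pass to the limit.\<close>

lemma bellman_mono_shift:
  fixes f :: "'q \<Rightarrow> 'u::finite \<Rightarrow> 'w::finite \<Rightarrow> 'q"
  assumes "\<And>q. J q \<le> K q + e"
  shows "bellman f \<sigma> J q \<le> bellman f \<sigma> K q + e"
proof -
  obtain u where u: "\<And>w. - \<sigma> q u w + K (f q u w) \<le> bellman f \<sigma> K q"
    using bellman_le_iff[of f \<sigma> K q "bellman f \<sigma> K q"] by auto
  have "- \<sigma> q u w + J (f q u w) \<le> bellman f \<sigma> K q + e" for w
    using u[of w] assms[of "f q u w"] by linarith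
  then show ?thesis by (auto simp: bellman_le_iff)
qed

lemma bellman_mono:
  fixes f :: "'q \<Rightarrow> 'u::finite \<Rightarrow> 'w::finite \<Rightarrow> 'q"
  assumes "\<And>q. J q \<le> K q"
  shows "bellman f \<sigma> J q \<le> bellman f \<sigma> K q"
  using bellman_mono_shift[of J K 0] assms by simp

lemma value_iter_le_Suc:
  "value_iter f \<sigma> k q \<le> value_iter f \<sigma> (Suc k) q"
proof (induction k arbitrary: q)
  case (Suc k)
  show ?case
    using bellman_mono[of "value_iter f \<sigma> k" "value_iter f \<sigma> (Suc k)" f \<sigma> q, OF Suc.IH] by auto
qed simp

lemma incseq_value_iter: "incseq (\<lambda>k. value_iter f \<sigma> k q)"
  by (rule incseq_SucI) (rule value_iter_le_Suc)

lemma value_iter_le_supersolution: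
  assumes "\<And>q. 0 \<le> J q" "\<And>q. bellman f \<sigma> J q \<le> J q"
  shows "value_iter f \<sigma> k q \<le> J q"
proof (induction k arbitrary: q)
  case (Suc k)
  then show ?case
    using bellman_mono[of "value_iter f \<sigma> k" J f \<sigma> q] assms by (auto intro: order_trans)
qed (simp add: assms)

lemma value_iter_converges:
  assumes "\<And>q. 0 \<le> J q" "\<And>q. bellman f \<sigma> J q \<le> J q"
  shows "\<exists>L. \<forall>q. (\<lambda>k. value_iter f \<sigma> k q) \<longlonglongrightarrow> L q"
proof -
  have "\<exists>l. (\<lambda>k. value_iter f \<sigma> k q) \<longlonglongrightarrow> l" for q
  proof (rule incseq_convergent[OF incseq_value_iter])
    show "\<forall>k. value_iter f \<sigma> k q \<le> J q"
      using value_iter_le_supersolution[OF assms] by simp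
  qed blast
  then show ?thesis by metis
qed

lemma limit_is_supersolution:
  fixes f :: "'q::finite \<Rightarrow> 'u::finite \<Rightarrow> 'w::finite \<Rightarrow> 'q"
  assumes lim: "\<And>q. (\<lambda>k. value_iter f \<sigma> k q) \<longlonglongrightarrow> L q"
  shows "0 \<le> L q" "bellman f \<sigma> L q \<le> L q"
proof -
  have below: "value_iter f \<sigma> k q \<le> L q" for k q
    by (rule incseq_le[OF incseq_value_iter lim])
  show "0 \<le> L q" using below[of 0] by simp
  show "bellman f \<sigma> L q \<le> L q"
  proof (rule field_le_epsilon)
    fix e :: real assume "0 < e"
    then have "\<forall>\<^sub>F k in sequentially. L p - e < value_iter f \<sigma> k p" for p
      using order_tendstoD(1)[OF lim] by simp
    then have "\<forall>\<^sub>F k in sequentially. \<forall>p. L p - e < value_iter f \<sigma> k p"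
      by (rule eventually_all_finite)
    then obtain k where k: "\<And>p. L p - e < value_iter f \<sigma> k p"
      by (auto simp: eventually_sequentially)
    have "bellman f \<sigma> L q \<le> bellman f \<sigma> (value_iter f \<sigma> k) q + e"
      using k by (intro bellman_mono_shift) (simp add: less_imp_le algebra_simps)
    also have "bellman f \<sigma> (value_iter f \<sigma> k) q \<le> value_iter f \<sigma> (Suc k) q" by simp
    also have "\<dots> \<le> L q" by (rule below)
    finally show "bellman f \<sigma> L q \<le> L q + e" by simp
  qed
qed

section \<open>Accumulated cost of input words\<close>

primrec word_cost :: "('q \<Rightarrow> 'w \<Rightarrow> 'q) \<Rightarrow> ('q \<Rightarrow> 'w \<Rightarrow> real) \<Rightarrow> 'q \<Rightarrow> 'w list \<Rightarrow> real" where
  "word_cost g c q [] = 0"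
| "word_cost g c q (w # ws) = c q w + word_cost g c (g q w) ws"

lemma word_cost_append:
  "word_cost g c q (us @ vs) = word_cost g c q us + word_cost g c (foldl g q us) vs"
  by (induction us arbitrary: q) auto

lemma traj_eq_foldl: "traj g q w t = foldl g q (map w [0..<t])"
  by (induction t) auto

lemma sum_traj_eq_word_cost:
  "(\<Sum>t<n. c (traj g q w t) (w t)) = word_cost g c q (map w [0..<n])"
  by (induction n) (auto simp: word_cost_append traj_eq_foldl)

section \<open>A uniform bound on the cost of all words\<close>

definition bounded_from :: "('q \<Rightarrow> 'w \<Rightarrow> 'q) \<Rightarrow> ('q \<Rightarrow> 'w \<Rightarrow> real) \<Rightarrow> 'q \<Rightarrow> bool" where
  "bounded_from g c q \<longleftrightarrow> bdd_above (range (word_cost g c q))"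

text \<open>The word is cut off just before its first step into a bounded state. There are finitely many
  such steps, and what follows each of them has bounded cost, which gives the constant \<open>M\<close>.\<close>

lemma prefix_staying_unbounded:
  fixes g :: "'q::finite \<Rightarrow> 'w::finite \<Rightarrow> 'q"
  obtains M where "\<And>q ws. \<not> bounded_from g c q \<Longrightarrow>
    \<exists>us. \<not> bounded_from g c (foldl g q us) \<and> word_cost g c q ws \<le> word_cost g c q us + M"
proof -
  have "\<exists>b. bounded_from g c p \<longrightarrow> (\<forall>ws. word_cost g c p ws \<le> b)" for p
    by (auto simp: bounded_from_def bdd_above_def)
  then obtain b where b: "\<And>p ws. bounded_from g c p \<Longrightarrow> word_cost g c p ws \<le> b p"
    by metis
  define M where "M = (\<Sum>(q, w)\<in>UNIV. \<bar>c q w + b (g q w)\<bar>)"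
  have M0: "0 \<le> M" unfolding M_def by (intro sum_nonneg) auto
  have M: "c q w + b (g q w) \<le> M" for q w
    using member_le_sum[of "(q, w)" UNIV "\<lambda>(q, w). \<bar>c q w + b (g q w)\<bar>"]
    by (auto simp: M_def)
  have "\<exists>us. \<not> bounded_from g c (foldl g q us) \<and> word_cost g c q ws \<le> word_cost g c q us + M"
    if "\<not> bounded_from g c q" for q ws
    using that
  proof (induction ws arbitrary: q)
    case Nil
    then show ?case using M0 by (intro exI[of _ "[]"]) auto
  next
    case (Cons w ws)
    show ?case
    proof (cases "bounded_from g c (g q w)")
      case True
      then have "word_cost g c q (w # ws) \<le> M"
        using b[of "g q w" ws] M[of q w] by simp
      then show ?thesis using Cons.prems by (intro exI[of _ "[]"]) auto
    next
      case False
      then obtain us where "\<not> bounded_from g c (foldl g (g q w) us)"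
        "word_cost g c (g q w) ws \<le> word_cost g c (g q w) us + M"
        using Cons.IH by blast
      then show ?thesis by (intro exI[of _ "w # us"]) auto
    qed
  qed
  then show ?thesis by (rule that)
qed

lemma unbounded_gain:
  fixes g :: "'q::finite \<Rightarrow> 'w::finite \<Rightarrow> 'q"
  assumes "\<not> bounded_from g c q"
  shows "\<exists>us. \<not> bounded_from g c (foldl g q us) \<and> 1 \<le> word_cost g c q us"
proof -
  obtain M where M: "\<And>q ws. \<not> bounded_from g c q \<Longrightarrow>
    \<exists>us. \<not> bounded_from g c (foldl g q us) \<and> word_cost g c q ws \<le> word_cost g c q us + M"
    using prefix_staying_unbounded[of g c] by blast
  obtain ws where ws: "1 + M < word_cost g c q ws"
    using assms by (auto simp: bounded_from_def bdd_above_def not_le)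
  obtain us where "\<not> bounded_from g c (foldl g q us)" "word_cost g c q ws \<le> word_cost g c q us + M"
    using M assms by blast
  with ws show ?thesis by (intro exI[of _ us]) auto
qed

lemma infinite_word_of_growing_prefixes:
  assumes grow: "\<And>n. \<exists>v. x (Suc n) = x n @ v" and long: "\<And>n. n \<le> length (x n)"
  obtains w where "\<And>n. map w [0..<length (x n)] = x n"
proof
  fix n
  have ext: "\<exists>v. x m = x k @ v" if "k \<le> m" for k m
    using that
  proof (induction rule: dec_induct)
    case (step m)
    then show ?case using grow[of m] by auto
  qed simp
  \<comment> \<open>Letter \<open>t\<close> is read off \<open>x (Suc t)\<close>, the first word that is guaranteed to have it.\<close>
  show "map (\<lambda>t. x (Suc t) ! t) [0..<length (x n)] = x n"
  proof (rule nth_equalityI)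
    fix t assume t: "t < length (map (\<lambda>t. x (Suc t) ! t) [0..<length (x n)])"
    have "t < length (x (Suc t))" using long[of "Suc t"] by simp
    moreover have "(\<exists>v. x n = x (Suc t) @ v) \<or> (\<exists>v. x (Suc t) = x n @ v)"
      using ext[of "Suc t" n] ext[of n "Suc t"] nat_le_linear by blast
    ultimately have "x (Suc t) ! t = x n ! t"
      using t by (auto simp: nth_append)
    then show "map (\<lambda>t. x (Suc t) ! t) [0..<length (x n)] ! t = x n ! t"
      using t by simp
  qed simp
qed

text \<open>A bound along each infinite input separately already forces a bound for all words at once:
  otherwise words of cost at least 1, each leading from one unbounded state to another, can be
  concatenated forever.\<close>

lemma bounded_word_cost:
  fixes g :: "'q::finite \<Rightarrow> 'w::finite \<Rightarrow> 'q"
  assumes bound: "\<And>w. \<exists>B. \<forall>n. (\<Sum>t<n. c (traj g q w t) (w t)) \<le> B"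
  shows "bounded_from g c q"
proof (rule ccontr)
  assume unb: "\<not> bounded_from g c q"
  \<comment> \<open>The length is tracked so that the words determine an infinite input.\<close>
  define P where "P n xs \<longleftrightarrow> \<not> bounded_from g c (foldl g q xs) \<and>
    real n \<le> word_cost g c q xs \<and> n \<le> length xs" for n xs
  have "\<exists>x. \<forall>n. P n (x n) \<and> (\<exists>v. x (Suc n) = x n @ v)"
  proof (rule dependent_nat_choice)
    show "\<exists>xs. P 0 xs" using unb by (intro exI[of _ "[]"]) (simp add: P_def)
  next
    fix xs n assume P: "P n xs"
    then obtain v where v: "\<not> bounded_from g c (foldl g (foldl g q xs) v)"
      "1 \<le> word_cost g c (foldl g q xs) v"
      using unbounded_gain[of g c "foldl g q xs"] by (auto simp: P_def)
    then have "v \<noteq> []" by auto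
    then have "1 \<le> length v" by (cases v) auto
    with P v have "P (Suc n) (xs @ v)"
      by (auto simp: P_def word_cost_append)
    then show "\<exists>ys. P (Suc n) ys \<and> (\<exists>v. ys = xs @ v)" by blast
  qed
  then obtain x where P: "\<And>n. P n (x n)" and grow: "\<And>n. \<exists>v. x (Suc n) = x n @ v" by blast
  obtain w where w: "\<And>n. map w [0..<length (x n)] = x n"
    using infinite_word_of_growing_prefixes[of x] grow P by (auto simp: P_def)
  obtain B where B: "\<And>n. (\<Sum>t<n. c (traj g q w t) (w t)) \<le> B"
    using bound by blast
  have "real n \<le> B" for n
    using B[of "length (x n)"] P[of n] by (simp add: sum_traj_eq_word_cost w P_def)
  then show False using reals_Archimedean2[of B] by (meson not_le)
qed

section \<open>Storage functions\<close>

lemma storage_function_exists: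
  assumes "\<And>q. bounded_from g c q"
  shows "\<exists>J. (\<forall>q. 0 \<le> J q) \<and> (\<forall>q w. c q w + J (g q w) \<le> J q)"
proof (intro exI conjI allI)
  let ?J = "\<lambda>q. SUP ws. word_cost g c q ws"
  have upper: "word_cost g c q ws \<le> ?J q" for q ws
    by (rule cSUP_upper) (use assms in \<open>auto simp: bounded_from_def\<close>)
  show "0 \<le> ?J q" for q using upper[of q "[]"] by simp
  show "c q w + ?J (g q w) \<le> ?J q" for q w
  proof -
    have "word_cost g c (g q w) ws \<le> ?J q - c q w" for ws
      using upper[of q "w # ws"] by simp
    then have "?J (g q w) \<le> ?J q - c q w" by (intro cSUP_least) auto
    then show ?thesis by simp
  qed
qed

text \<open>Dissipation telescopes along trajectories.\<close>

lemma storage_function_bounds_cost: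
  assumes "\<And>q w. c q w + J (g q w) \<le> J q"
  shows "(\<Sum>t<n. c (traj g q w t) (w t)) + J (traj g q w n) \<le> (J q :: real)"
proof (induction n)
  case (Suc n)
  then show ?case using assms[of "traj g q w n" "w n"] by simp
qed simp

lemma INF_ereal_gt_MInf_iff:
  "(INF T. ereal (a T)) > - \<infinity> \<longleftrightarrow> (\<exists>B. \<forall>T. B \<le> a T)"
proof
  assume "(INF T. ereal (a T)) > - \<infinity>"
  then obtain B :: real where B: "ereal B < (INF T. ereal (a T))"
    using ereal_dense2 by blast
  have "B \<le> a T" for T
    using less_le_trans[OF B INF_lower[of T UNIV]] by simp
  then show "\<exists>B. \<forall>T. B \<le> a T" by blast
next
  assume "\<exists>B. \<forall>T. B \<le> a T"
  then obtain B where "\<And>T. B \<le> a T" by blast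
  then have "ereal B \<le> (INF T. ereal (a T))" by (intro INF_greatest) simp
  then show "(INF T. ereal (a T)) > - \<infinity>"
    by (rule less_le_trans[rotated]) simp
qed

section \<open>The equivalence\<close>

theorem theorem2:
  fixes f :: "'q::finite \<Rightarrow> 'u::finite \<Rightarrow> 'w::finite \<Rightarrow> 'q"
    and \<sigma> :: "'q \<Rightarrow> 'u \<Rightarrow> 'w \<Rightarrow> real"
  defines "stmt_a \<equiv> \<exists>\<phi> :: 'q \<Rightarrow> 'u. \<forall>(w :: nat \<Rightarrow> 'w) (q0 :: 'q).
      (INF T. ereal (\<Sum>t=0..T. let q = traj (closed_loop f \<phi>) q0 w t in \<sigma> q (\<phi> q) (w t))) > - \<infinity>"
    and "stmt_b \<equiv> \<exists>J :: 'q \<Rightarrow> real. (\<forall>q. J q \<ge> 0) \<and> (\<forall>q. J q \<ge> bellman f \<sigma> J q)"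
    and "stmt_c \<equiv> \<exists>L :: 'q \<Rightarrow> real. \<forall>q. (\<lambda>k. value_iter f \<sigma> k q) \<longlonglongrightarrow> L q"
  shows "(stmt_a \<longleftrightarrow> stmt_b) \<and> (stmt_b \<longleftrightarrow> stmt_c)"
proof -
  define cost where "cost \<phi> q w = - \<sigma> q (\<phi> q) w" for \<phi> q w
  have sum_cost: "(\<Sum>t=0..T. let q = traj (closed_loop f \<phi>) q0 w t in \<sigma> q (\<phi> q) (w t))
      = - (\<Sum>t<Suc T. cost \<phi> (traj (closed_loop f \<phi>) q0 w t) (w t))" for \<phi> q0 w T
    by (simp add: cost_def Let_def sum_negf atLeast0AtMost lessThan_Suc_atMost del: sum.lessThan_Suc)
  have a: "stmt_a \<longleftrightarrow> (\<exists>\<phi>. \<forall>w q0. \<exists>B. \<forall>T.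
      B \<le> - (\<Sum>t<Suc T. cost \<phi> (traj (closed_loop f \<phi>) q0 w t) (w t)))"
    unfolding stmt_a_def sum_cost INF_ereal_gt_MInf_iff ..
  have "stmt_a \<Longrightarrow> stmt_b"
  proof -
    assume stmt_a
    then obtain \<phi> where \<phi>: "\<And>w q0. \<exists>B. \<forall>T.
      B \<le> - (\<Sum>t<Suc T. cost \<phi> (traj (closed_loop f \<phi>) q0 w t) (w t))"
      unfolding a by blast
    have "\<exists>B. \<forall>n. (\<Sum>t<n. cost \<phi> (traj (closed_loop f \<phi>) q w t) (w t)) \<le> B" for q w
    proof -
      obtain B where B: "\<And>T. B \<le> - (\<Sum>t<Suc T. cost \<phi> (traj (closed_loop f \<phi>) q w t) (w t))"
        using \<phi> by blast
      \<comment> \<open>The maximum with 0 covers the empty sum; those in (a) have at least one term.\<close>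
      have "(\<Sum>t<n. cost \<phi> (traj (closed_loop f \<phi>) q w t) (w t)) \<le> max 0 (- B)" for n
      proof (cases n)
        case (Suc T)
        show ?thesis using B[of T] unfolding Suc le_max_iff_disj by linarith
      qed simp
      then show ?thesis by blast
    qed
    then have "bounded_from (closed_loop f \<phi>) (cost \<phi>) q" for q
      by (rule bounded_word_cost)
    then obtain J where "\<And>q. 0 \<le> J q" "\<And>q w. cost \<phi> q w + J (closed_loop f \<phi> q w) \<le> J q"
      using storage_function_exists[of "closed_loop f \<phi>" "cost \<phi>"] by blast
    then show stmt_b
      unfolding stmt_b_def bellman_le_iff cost_def closed_loop_def by blast
  qed
  moreover have "stmt_b \<Longrightarrow> stmt_a"
  proof -
    assume stmt_b
    then obtain J where J0: "\<And>q. 0 \<le> J q"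
      and "\<And>q. \<exists>u. \<forall>w. - \<sigma> q u w + J (f q u w) \<le> J q"
      unfolding stmt_b_def bellman_le_iff by blast
    then obtain \<phi> where "\<And>q w. - \<sigma> q (\<phi> q) w + J (f q (\<phi> q) w) \<le> J q" by metis
    then have diss: "cost \<phi> q w + J (closed_loop f \<phi> q w) \<le> J q" for q w
      by (simp add: cost_def closed_loop_def)
    have "- J q0 \<le> - (\<Sum>t<Suc T. cost \<phi> (traj (closed_loop f \<phi>) q0 w t) (w t))" for w q0 T
      using storage_function_bounds_cost[where c = "cost \<phi>" and J = J and
          g = "closed_loop f \<phi>" and n = "Suc T" and q = q0 and w = w, OF diss]
        J0[of "traj (closed_loop f \<phi>) q0 w (Suc T)"] by linarith
    then show stmt_a unfolding a by blast
  qed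
  moreover have "stmt_b \<Longrightarrow> stmt_c"
  proof -
    assume stmt_b
    then obtain J where "\<And>q. 0 \<le> J q" "\<And>q. bellman f \<sigma> J q \<le> J q"
      unfolding stmt_b_def by blast
    then show stmt_c unfolding stmt_c_def by (rule value_iter_converges)
  qed
  moreover have "stmt_c \<Longrightarrow> stmt_b"
  proof -
    assume stmt_c
    then obtain L where "\<And>q. (\<lambda>k. value_iter f \<sigma> k q) \<longlonglongrightarrow> L q"
      unfolding stmt_c_def by blast
    from limit_is_supersolution[OF this] show stmt_b
      unfolding stmt_b_def by blast
  qed
  ultimately show ?thesis by blast
qed

end
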